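(* Let $T\in B(H)$. Then the following properties are equivalent. (i) $0\in W_e(T)$. (ii) For any sequence $(a_n)_{n=1}^\infty\subset(0,\infty)$ satisfying $(a_n)_{n=1}^\infty\notin\ell^1(\mathbb N)$ there exists an orthonormal basis $(u_n)_{n=1}^\infty$ in $H$ such that $$|\langle Tu_n,u_j\rangle|\le\sqrt{a_na_j}$$ for all $n,j\in\mathbb N$.
   Context: $H$ is a separable infinite-dimensional complex Hilbert space and $B(H)$ is the space of bounded linear operators on $H$. $\mathbb N=\{1,2,\dots\}$. The essential numerical range $W_e(T)\subset\mathbb C$ of $T\in B(H)$ is the set of all $\lambda\in\mathbb C$ for which there exists an orthonormal sequence $(e_n)_{n=1}^\infty\subset H$ with $\langle Te_n,e_n\rangle\to\lambda$ as $n\to\infty$. *)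

theory Defs
  imports "HOL-Analysis.Analysis"
begin

class complex_vector = real_vector +
  fixes scaleC :: "complex \<Rightarrow> 'a \<Rightarrow> 'a" (infixr "*\<^sub>C" 75)
  assumes scaleC_add_right: "c *\<^sub>C (x + y) = c *\<^sub>C x + c *\<^sub>C y"
    and scaleC_add_left: "(c + d) *\<^sub>C x = c *\<^sub>C x + d *\<^sub>C x"
    and scaleC_scaleC: "c *\<^sub>C (d *\<^sub>C x) = (c * d) *\<^sub>C x"
    and scaleC_one: "1 *\<^sub>C x = x"
    and scaleR_eq_scaleC: "r *\<^sub>R x = complex_of_real r *\<^sub>C x"

global_interpretation complex_vector: vector_space "scaleC :: complex \<Rightarrow> 'a \<Rightarrow> 'a::complex_vector"
  by unfold_locales (rule scaleC_add_right scaleC_add_left scaleC_scaleC scaleC_one)+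

text \<open>A complex inner product, linear in the first argument. The class extends
  \<open>real_inner\<close> so that the library theory of norm, metric and topology applies; the
  real inner product is the real part of the complex one, hence carries no extra data.
  Positive definiteness is inherited from \<open>real_inner\<close>, see \<open>cinner_self\<close> and
  \<open>cinner_eq_zero_iff\<close> below.\<close>

class complex_inner = complex_vector + real_inner +
  fixes cinner :: "'a \<Rightarrow> 'a \<Rightarrow> complex"
  assumes cinner_commute: "cinner x y = cnj (cinner y x)"
    and cinner_add_left: "cinner (x + y) z = cinner x z + cinner y z"
    and cinner_scaleC_left: "cinner (c *\<^sub>C x) y = c * cinner x y"
    and inner_eq_Re_cinner: "inner x y = Re (cinner x y)"

class complex_hilbert_space = complex_inner + complete_space

lemma cinner_self: "cinner x x = complex_of_real ((norm x)\<^sup>2)"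
  for x :: "'a::complex_inner"
proof (rule complex_eqI)
  show "Re (cinner x x) = Re (complex_of_real ((norm x)\<^sup>2))"
    by (simp add: power2_norm_eq_inner inner_eq_Re_cinner)
  have "Im (cinner x x) = - Im (cinner x x)"
    using arg_cong[OF cinner_commute[of x x], of Im] by simp
  then show "Im (cinner x x) = Im (complex_of_real ((norm x)\<^sup>2))"
    by simp
qed

lemma cinner_eq_zero_iff: "cinner x x = 0 \<longleftrightarrow> x = 0"
  for x :: "'a::complex_inner"
  by (simp add: cinner_self)

definition bounded_clinear :: "('a::complex_inner \<Rightarrow> 'b::complex_inner) \<Rightarrow> bool" where
  "bounded_clinear T \<longleftrightarrow> bounded_linear T \<and> (\<forall>c x. T (c *\<^sub>C x) = c *\<^sub>C T x)"

text \<open>Sequences indexed by the positive integers are modelled as functions on \<open>nat\<close>,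
  with indices shifted to start from \<open>0\<close>.\<close>

definition orthonormal_sequence :: "(nat \<Rightarrow> 'a::complex_inner) \<Rightarrow> bool" where
  "orthonormal_sequence e \<longleftrightarrow> (\<forall>m n. cinner (e m) (e n) = (if m = n then 1 else 0))"

definition orthonormal_basis :: "(nat \<Rightarrow> 'a::complex_inner) \<Rightarrow> bool" where
  "orthonormal_basis u \<longleftrightarrow>
     orthonormal_sequence u \<and> closure (complex_vector.span (range u)) = UNIV"

definition essential_numerical_range :: "('a::complex_inner \<Rightarrow> 'a) \<Rightarrow> complex set" where
  "essential_numerical_range T =
     {l. \<exists>e. orthonormal_sequence e \<and> (\<lambda>n. cinner (T (e n)) (e n)) \<longlonglongrightarrow> l}"

end

theory Submission
  imports Defs
begin

text \<open>
  That small matrices force \<open>0\<close> into the essential numerical range follows from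
  \<open>a n = 1 / (n + 1)\<close>: the diagonal of \<open>T\<close> in the resulting basis tends to zero.

  For the converse, \<open>0\<close> in the essential numerical range provides unit vectors that \<open>T\<close> does not
  see: given finitely many bounded functionals there is a unit vector \<open>v\<close> in their common kernel with
  \<open>cinner (T v) v\<close> arbitrarily small (\<open>unit_vector_in_kernels_small_form\<close>). A basis made only of such
  vectors would have a tiny matrix, but such vectors need not span. So \<open>H\<close> gets an orthonormal basis
  in two parts (\<open>split_orthonormal_basis\<close>): vectors \<open>v n\<close> of this kind, for which the matrix of
  \<open>T\<close> vanishes between \<open>v n\<close> and all vectors chosen before, and vectors \<open>e k\<close> that carry what remains
  of a dense sequence and on which \<open>T\<close> is not controlled at all.

  The \<open>e k\<close> are then fed into the basis in small portions. Step \<open>n\<close> works on one index \<open>\<kappa> n\<close>: with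
  \<open>w\<close> the part of \<open>e (\<kappa> n)\<close> not captured yet, normalized, the new basis vector is
  \<open>u n = sqrt (1 - t n) v n + sqrt (t n) w\<close>, and \<open>w\<close> is replaced by the vector orthogonal to \<open>u n\<close> in
  the same plane. Two things are weighed against each other.

  \<^item> The uncaptured part shrinks by the factor \<open>sqrt (1 - t n)\<close>. It tends to zero as soon as the sum of
    \<open>t n\<close> over all steps with \<open>\<kappa> n = k\<close> diverges, for every \<open>k\<close> (\<open>w_in_closure\<close>).
  \<^item> The entries of the matrix of \<open>T\<close> in the basis \<open>u\<close> are \<open>O(sqrt (t n * t j))\<close>, because the
    contribution of \<open>v n\<close> is negligible and the entry of \<open>w\<close> against an earlier \<open>u j\<close> is
    \<open>O(sqrt (t j))\<close> (\<open>B_w_u\<close>). This can fail only for the finitely many \<open>j < \<kappa> n\<close>, where the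
    entry is still \<open>O(sqrt (t n))\<close>.

  Taking \<open>t n = c (\<kappa> n) * a n\<close> with constants \<open>c k\<close> small enough meets both demands: the constants
  absorb the operator norm and the finitely many exceptional \<open>j\<close>, and do not affect divergence. It
  remains to distribute a divergent series over infinitely many indices so that each part
  still diverges (\<open>split_divergent_series\<close>).
\<close>

section \<open>Bounded forms on a complex inner product space\<close>

lemma cinner_scaleR_left: "cinner (r *\<^sub>R x) y = complex_of_real r * cinner x y"
  by (simp add: scaleR_eq_scaleC cinner_scaleC_left)

lemma cinner_scaleC_right: "cinner x (c *\<^sub>C y) = cnj c * cinner x y"
  by (metis cinner_commute cinner_scaleC_left complex_cnj_mult)

lemma norm_scaleC: "norm (c *\<^sub>C x) = cmod c * norm (x :: 'a::complex_inner)"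
proof -
  have "complex_of_real ((norm (c *\<^sub>C x))\<^sup>2) = complex_of_real ((cmod c * norm x)\<^sup>2)"
    unfolding cinner_self[symmetric] cinner_scaleC_left cinner_scaleC_right
    by (simp add: cinner_self power_mult_distrib complex_norm_square[symmetric] mult_ac
        flip: mult.assoc)
  then have "(norm (c *\<^sub>C x))\<^sup>2 = (cmod c * norm x)\<^sup>2"
    using of_real_eq_iff by blast
  then show ?thesis by (simp add: power2_eq_iff_nonneg)
qed

lemma norm_eq_1_cinner:
  assumes "cinner x x = 1"
  shows "norm x = 1"
proof -
  have "complex_of_real ((norm x)\<^sup>2) = complex_of_real 1"
    using assms unfolding cinner_self by simp
  then have "(norm x)\<^sup>2 = 1\<^sup>2" using of_real_eq_iff by (metis one_power2)
  then show ?thesis by (simp only: power2_eq_iff_nonneg norm_ge_zero zero_le_one)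
qed

lemma Cauchy_Schwarz_cinner: "cmod (cinner x y) \<le> norm x * norm y"
proof (cases "cinner x y = 0")
  case False
  \<comment> \<open>Multiplying \<open>x\<close> by a phase makes the inner product real, where it is the real inner product.\<close>
  define c where "c = cnj (cinner x y) / cmod (cinner x y)"
  have c: "cmod c = 1" using False by (simp add: c_def norm_divide)
  have "c * cinner x y = complex_of_real ((cmod (cinner x y))\<^sup>2) / cmod (cinner x y)"
    unfolding complex_norm_square c_def by (simp add: mult.commute)
  then have "c * cinner x y = complex_of_real (cmod (cinner x y))"
    using False by (simp add: power2_eq_square)
  then have "cmod (cinner x y) = inner (c *\<^sub>C x) y"
    by (simp add: inner_eq_Re_cinner cinner_scaleC_left)
  also have "\<dots> \<le> norm (c *\<^sub>C x) * norm y" by (rule norm_cauchy_schwarz)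
  finally show ?thesis by (simp add: norm_scaleC c)
qed simp

interpretation cinner: bounded_bilinear "cinner :: 'a::complex_inner \<Rightarrow> 'a \<Rightarrow> complex"
proof
  fix x y z :: 'a and r :: real
  show "cinner (x + y) z = cinner x z + cinner y z" by (rule cinner_add_left)
  show "cinner x (y + z) = cinner x y + cinner x z"
    by (metis cinner_commute cinner_add_left complex_cnj_add)
  show "cinner (r *\<^sub>R x) y = r *\<^sub>R cinner x y"
    by (simp add: cinner_scaleR_left scaleR_conv_of_real)
  show "cinner x (r *\<^sub>R y) = r *\<^sub>R cinner x y"
    by (simp add: scaleR_eq_scaleC cinner_scaleC_right scaleR_conv_of_real)
  show "\<exists>K. \<forall>a b :: 'a. cmod (cinner a b) \<le> norm a * norm b * K"
    by (rule exI[of _ 1]) (simp add: Cauchy_Schwarz_cinner)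
qed

definition bounded_functional :: "('a::complex_inner \<Rightarrow> complex) \<Rightarrow> bool" where
  "bounded_functional \<phi> \<longleftrightarrow> bounded_linear \<phi> \<and> (\<forall>c x. \<phi> (c *\<^sub>C x) = c * \<phi> x)"

lemma bounded_functional_cinner: "bounded_functional (\<lambda>x. cinner x y)"
  by (simp add: bounded_functional_def cinner.bounded_linear_left cinner_scaleC_left)

lemma bounded_functional_cinner_image:
  assumes "bounded_clinear T"
  shows "bounded_functional (\<lambda>x. cinner (T x) y)"
  using assms bounded_linear_compose[OF cinner.bounded_linear_left]
  by (auto simp: bounded_functional_def bounded_clinear_def cinner_scaleC_left)

section \<open>Small quadratic form on subspaces of finite codimension\<close>

lemma norm_sum_orthonormal:
  assumes "orthonormal_sequence e"
  shows "(norm (\<Sum>n<N. c n *\<^sub>C e n))\<^sup>2 = (\<Sum>n<N. (cmod (c n))\<^sup>2)"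
proof -
  have "cinner (\<Sum>n<N. c n *\<^sub>C e n) (\<Sum>n<N. c n *\<^sub>C e n)
      = (\<Sum>m<N. \<Sum>n<N. cnj (c m) * (c n * cinner (e n) (e m)))"
    by (simp add: cinner.sum_left cinner.sum_right cinner_scaleC_left cinner_scaleC_right sum_distrib_left)
  also have "\<dots> = (\<Sum>m<N. \<Sum>n<N. if n = m then c m * cnj (c m) else 0)"
    using assms by (intro sum.cong refl) (auto simp: orthonormal_sequence_def)
  also have "\<dots> = complex_of_real (\<Sum>n<N. (cmod (c n))\<^sup>2)"
    by (simp add: complex_norm_square del: of_real_power)
  finally show ?thesis unfolding cinner_self using of_real_eq_iff by blast
qed

text \<open>Bessel's inequality for a functional rather than for a vector. Testing the functional on
  the vector with coefficients \<open>cnj (\<phi> (e n))\<close> avoids representing it by a vector, so that no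
  adjoint of an operator is ever required.\<close>

lemma bounded_functional_orthonormal_tendsto_0:
  assumes \<phi>: "bounded_functional \<phi>" and e: "orthonormal_sequence e"
  shows "(\<lambda>n. \<phi> (e n)) \<longlonglongrightarrow> 0"
proof -
  from \<phi> interpret bounded_linear \<phi> by (simp add: bounded_functional_def)
  obtain K where K: "\<And>x. cmod (\<phi> x) \<le> norm x * K" "K \<ge> 0"
    using nonneg_bounded by blast
  have bound: "(\<Sum>n<N. (cmod (\<phi> (e n)))\<^sup>2) \<le> K\<^sup>2" for N
  proof -
    define S where "S = (\<Sum>n<N. (cmod (\<phi> (e n)))\<^sup>2)"
    define x where "x = (\<Sum>n<N. cnj (\<phi> (e n)) *\<^sub>C e n)"
    have S0: "S \<ge> 0" unfolding S_def by (simp add: sum_nonneg)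
    have "\<phi> x = (\<Sum>n<N. cnj (\<phi> (e n)) * \<phi> (e n))"
      using \<phi> by (simp add: x_def sum bounded_functional_def)
    also have "\<dots> = complex_of_real S"
      by (simp add: S_def complex_norm_square mult.commute del: of_real_power)
    finally have "S \<le> norm x * K" using K(1)[of x] S0 by simp
    moreover have "(norm x)\<^sup>2 = S"
      using norm_sum_orthonormal[OF e, of "\<lambda>n. cnj (\<phi> (e n))" N] by (simp add: x_def S_def)
    ultimately have "norm x * norm x \<le> norm x * K" by (simp add: power2_eq_square)
    then have "norm x \<le> K" using K(2) by (cases "norm x = 0") auto
    then show ?thesis using \<open>(norm x)\<^sup>2 = S\<close> S_def by (metis norm_ge_zero power_mono)
  qed
  have "summable (\<lambda>n. (cmod (\<phi> (e n)))\<^sup>2)"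
    by (rule summableI_nonneg_bounded[where x = "K\<^sup>2"]) (use bound in auto)
  then have "(\<lambda>n. sqrt ((cmod (\<phi> (e n)))\<^sup>2)) \<longlonglongrightarrow> sqrt 0"
    by (intro tendsto_real_sqrt summable_LIMSEQ_zero)
  then show ?thesis using tendsto_norm_zero_iff by fastforce
qed

text \<open>An orthonormal sequence can be pushed into the common kernel of finitely many functionals
  by corrections that tend to zero in norm: if \<open>\<phi>\<close> is not already zero on the kernel of the others,
  pick \<open>g\<close> in that kernel with \<open>\<phi> g \<noteq> 0\<close> and subtract \<open>\<phi> (x n) / \<phi> g\<close> times \<open>g\<close>.
  The corrected sequence is asymptotically normalized, and the quadratic form of \<open>T\<close> along it still
  tends to zero.\<close>

lemma weakly_null_sequence_in_kernels:
  fixes T :: "'a::complex_inner \<Rightarrow> 'a"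
  assumes T: "bounded_clinear T" and W: "0 \<in> essential_numerical_range T"
    and "finite \<Phi>" "\<And>\<phi>. \<phi> \<in> \<Phi> \<Longrightarrow> bounded_functional \<phi>"
  shows "\<exists>x. (\<forall>\<phi>\<in>\<Phi>. \<forall>n. \<phi> (x n) = 0) \<and> (\<lambda>n. norm (x n)) \<longlonglongrightarrow> 1 \<and>
    (\<lambda>n. cinner (T (x n)) (x n)) \<longlonglongrightarrow> 0 \<and> (\<forall>\<psi>. bounded_functional \<psi> \<longrightarrow> (\<lambda>n. \<psi> (x n)) \<longlonglongrightarrow> 0)"
  using assms(3,4)
proof (induction \<Phi> rule: finite_induct)
  case empty
  from W obtain e where e: "orthonormal_sequence e" "(\<lambda>n. cinner (T (e n)) (e n)) \<longlonglongrightarrow> 0"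
    by (auto simp: essential_numerical_range_def)
  have "norm (e n) = 1" for n
    using e(1) by (intro norm_eq_1_cinner) (simp add: orthonormal_sequence_def)
  then show ?case using e bounded_functional_orthonormal_tendsto_0 by (intro exI[of _ e]) auto
next
  case (insert \<phi> \<Phi>)
  from insert obtain x where x: "\<And>\<psi> n. \<psi> \<in> \<Phi> \<Longrightarrow> \<psi> (x n) = 0" "(\<lambda>n. norm (x n)) \<longlonglongrightarrow> 1"
    "(\<lambda>n. cinner (T (x n)) (x n)) \<longlonglongrightarrow> 0" "\<And>\<psi>. bounded_functional \<psi> \<Longrightarrow> (\<lambda>n. \<psi> (x n)) \<longlonglongrightarrow> 0"
    by blast
  show ?case
  proof (cases "\<exists>g. (\<forall>\<psi>\<in>\<Phi>. \<psi> g = 0) \<and> \<phi> g \<noteq> 0")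
    case False
    then show ?thesis using x by (intro exI[of _ x]) auto
  next
    case True
    then obtain g where g: "\<And>\<psi>. \<psi> \<in> \<Phi> \<Longrightarrow> \<psi> g = 0" "\<phi> g \<noteq> 0" by blast
    define d where "d = (\<lambda>n. (\<phi> (x n) / \<phi> g) *\<^sub>C g)"
    define y where "y = (\<lambda>n. x n - d n)"
    have "(\<lambda>n. cmod (\<phi> (x n) / \<phi> g) * norm g) \<longlonglongrightarrow> cmod (0 / \<phi> g) * norm g"
      using x(4) insert.prems g(2) by (intro tendsto_intros) auto
    then have d0: "d \<longlonglongrightarrow> 0"
      by (subst tendsto_norm_zero_iff[symmetric]) (simp add: d_def norm_scaleC)
    have lin: "\<psi> (y n) = \<psi> (x n) - \<phi> (x n) / \<phi> g * \<psi> g" if "bounded_functional \<psi>" for \<psi> n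
    proof -
      from that interpret bounded_linear \<psi> by (simp add: bounded_functional_def)
      show ?thesis using that by (simp add: y_def d_def diff bounded_functional_def)
    qed
    have ker: "\<psi> (y n) = 0" if "\<psi> \<in> insert \<phi> \<Phi>" for \<psi> n
    proof (cases "\<psi> = \<phi>")
      case True
      then show ?thesis using lin[of \<phi> n] insert.prems g(2) by simp
    next
      case False
      then have "\<psi> \<in> \<Phi>" using that by blast
      then show ?thesis
        using lin[of \<psi> n] insert.prems x(1)[of \<psi> n] g(1)[of \<psi>] by simp
    qed
    have null: "(\<lambda>n. \<psi> (y n)) \<longlonglongrightarrow> 0" if "bounded_functional \<psi>" for \<psi>
    proof -
      have "(\<lambda>n. \<psi> (x n) - \<phi> (x n) / \<phi> g * \<psi> g) \<longlonglongrightarrow> 0 - 0 / \<phi> g * \<psi> g"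
        using x(4) insert.prems that g(2) by (intro tendsto_intros) auto
      then show ?thesis using lin[OF that] by simp
    qed
    have xn: "Bseq x"
      using convergent_imp_Bseq[OF convergentI[OF x(2)]] by (simp add: Bseq_def)
    have "(\<lambda>n. norm (y n) - norm (x n)) \<longlonglongrightarrow> 0"
      by (rule Lim_null_comparison[OF _ tendsto_norm_zero[OF d0]])
        (auto simp: y_def norm_triangle_ineq3 intro!: always_eventually
          order_trans[OF norm_triangle_ineq3])
    from tendsto_add[OF this x(2)] have ny: "(\<lambda>n. norm (y n)) \<longlonglongrightarrow> 1" by simp
    interpret T: bounded_linear T using T by (simp add: bounded_clinear_def)
    have zero: "Zfun (\<lambda>n. cinner (T (d n)) (x n)) sequentially"
       "Zfun (\<lambda>n. cinner (T (x n)) (d n)) sequentially"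
       "Zfun (\<lambda>n. cinner (T (d n)) (d n)) sequentially"
    proof -
      have dz: "Zfun d sequentially" using d0 by (simp add: tendsto_Zfun_iff)
      have xb: "Bfun x sequentially" using xn .
      have Txb: "Bfun (\<lambda>n. T (x n)) sequentially"
      proof -
        obtain B where "\<And>n. norm (x n) \<le> B" using xn unfolding Bseq_def by blast
        obtain K where K: "\<And>z. norm (T z) \<le> norm z * K" "K \<ge> 0" using T.nonneg_bounded by blast
        have "norm (T (x n)) \<le> B * K" for n
          using K(1)[of "x n"] mult_right_mono[OF \<open>norm (x n) \<le> B\<close> K(2)] by linarith
        then show ?thesis by (intro BfunI[of _ "B * K"] always_eventually allI)
      qed
      show "Zfun (\<lambda>n. cinner (T (d n)) (x n)) sequentially"
        by (rule cinner.Zfun_prod_Bfun[OF T.Zfun[OF dz] xb])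
      show "Zfun (\<lambda>n. cinner (T (x n)) (d n)) sequentially"
        by (rule cinner.Bfun_prod_Zfun[OF Txb dz])
      show "Zfun (\<lambda>n. cinner (T (d n)) (d n)) sequentially"
        by (rule cinner.Zfun[OF T.Zfun[OF dz] dz])
    qed
    have "(\<lambda>n. cinner (T (x n)) (x n) - cinner (T (d n)) (x n) - cinner (T (x n)) (d n)
        + cinner (T (d n)) (d n)) \<longlonglongrightarrow> 0 - 0 - 0 + 0"
      using x(3) zero by (intro tendsto_intros) (simp_all add: tendsto_Zfun_iff)
    moreover have "cinner (T (y n)) (y n) = cinner (T (x n)) (x n) - cinner (T (d n)) (x n)
        - cinner (T (x n)) (d n) + cinner (T (d n)) (d n)" for n
      by (simp add: y_def T.diff cinner.diff_left cinner.diff_right)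
    ultimately have "(\<lambda>n. cinner (T (y n)) (y n)) \<longlonglongrightarrow> 0" by simp
    with ker null ny show ?thesis by (intro exI[of _ y]) auto
  qed
qed

lemma unit_vector_in_kernels_small_form:
  fixes T :: "'a::complex_inner \<Rightarrow> 'a"
  assumes T: "bounded_clinear T" and W: "0 \<in> essential_numerical_range T"
    and "finite \<Phi>" "\<And>\<phi>. \<phi> \<in> \<Phi> \<Longrightarrow> bounded_functional \<phi>" and "\<epsilon> > 0"
  obtains v where "norm v = 1" "\<And>\<phi>. \<phi> \<in> \<Phi> \<Longrightarrow> \<phi> v = 0" "cmod (cinner (T v) v) < \<epsilon>"
proof -
  obtain x where x: "\<And>\<phi> n. \<phi> \<in> \<Phi> \<Longrightarrow> \<phi> (x n) = 0" "(\<lambda>n. norm (x n)) \<longlonglongrightarrow> 1"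
    "(\<lambda>n. cinner (T (x n)) (x n)) \<longlonglongrightarrow> 0"
    using weakly_null_sequence_in_kernels[OF assms(1-4)] by blast
  have "(\<lambda>n. cmod (cinner (T (x n)) (x n)) / (norm (x n))\<^sup>2) \<longlonglongrightarrow> cmod 0 / 1\<^sup>2"
    using x(2,3) by (intro tendsto_intros) auto
  then have "\<forall>\<^sub>F n in sequentially. cmod (cinner (T (x n)) (x n)) / (norm (x n))\<^sup>2 < \<epsilon>"
    using \<open>\<epsilon> > 0\<close> by (intro order_tendstoD) auto
  moreover have "\<forall>\<^sub>F n in sequentially. norm (x n) > 0"
    using x(2) by (intro order_tendstoD) auto
  ultimately have "\<forall>\<^sub>F n in sequentially. cmod (cinner (T (x n)) (x n)) / (norm (x n))\<^sup>2 < \<epsilon> \<and> norm (x n) > 0"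
    by eventually_elim simp
  then obtain n where n: "cmod (cinner (T (x n)) (x n)) / (norm (x n))\<^sup>2 < \<epsilon>" "norm (x n) > 0"
    using eventually_happens trivial_limit_sequentially by (metis (mono_tags, lifting) sequentially_bot)
  interpret T: bounded_linear T using T by (simp add: bounded_clinear_def)
  define v where "v = (1 / norm (x n)) *\<^sub>R x n"
  have "cinner (T v) v = (1 / (norm (x n))\<^sup>2) *\<^sub>R cinner (T (x n)) (x n)"
    by (simp add: v_def T.scaleR cinner.scaleR_left cinner.scaleR_right power2_eq_square)
  then have "cmod (cinner (T v) v) = cmod (cinner (T (x n)) (x n)) / (norm (x n))\<^sup>2"
    by simp
  moreover have "\<phi> v = 0" if "\<phi> \<in> \<Phi>" for \<phi>
  proof -
    from that assms interpret bounded_linear \<phi> by (simp add: bounded_functional_def)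
    show ?thesis using x(1)[OF that] by (simp add: v_def scaleR)
  qed
  ultimately show ?thesis using n by (intro that[of v]) (auto simp: v_def)
qed

section \<open>An orthonormal basis split into two sequences\<close>

lemma orthogonal_decomposition_finite:
  fixes z :: "nat \<Rightarrow> 'a::complex_inner"
  assumes "\<And>i j. i < m \<Longrightarrow> j < m \<Longrightarrow> cinner (z i) (z j) = (if i = j then 1 else 0)"
  obtains f g where "x = f + g" "f \<in> complex_vector.span (z ` {..<m})"
    "\<And>i. i < m \<Longrightarrow> cinner g (z i) = 0"
proof
  define f where "f = (\<Sum>i<m. cinner x (z i) *\<^sub>C z i)"
  show "x = f + (x - f)" by simp
  show "f \<in> complex_vector.span (z ` {..<m})" unfolding f_def
    by (intro complex_vector.span_sum complex_vector.span_scale complex_vector.span_base) auto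
  show "cinner (x - f) (z i) = 0" if "i < m" for i
  proof -
    have "cinner f (z i) = (\<Sum>j<m. if j = i then cinner x (z i) else 0)"
      unfolding f_def cinner.sum_left
      using assms that by (intro sum.cong) (auto simp: cinner_scaleC_left)
    then show ?thesis using that by (simp add: cinner.diff_left)
  qed
qed

text \<open>The vector is the normalized component of \<open>x\<close> orthogonal to the \<open>z i\<close>. If that component is zero
  then any unit vector orthogonal to the \<open>z i\<close> will do.\<close>

lemma unit_vector_capturing_in_span:
  fixes T :: "'a::complex_inner \<Rightarrow> 'a" and z :: "nat \<Rightarrow> 'a"
  assumes T: "bounded_clinear T" and W: "0 \<in> essential_numerical_range T"
    and z: "\<And>i j. i < m \<Longrightarrow> j < m \<Longrightarrow> cinner (z i) (z j) = (if i = j then 1 else 0)"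
  obtains r where "norm r = 1" "\<And>i. i < m \<Longrightarrow> cinner r (z i) = 0"
    "x \<in> complex_vector.span (insert r (z ` {..<m}))"
proof -
  obtain f g where fg: "x = f + g" "f \<in> complex_vector.span (z ` {..<m})"
    "\<And>i. i < m \<Longrightarrow> cinner g (z i) = 0"
    using orthogonal_decomposition_finite[of m z x] z by blast
  have f: "f \<in> complex_vector.span (insert r (z ` {..<m}))" for r
    using fg(2) complex_vector.span_mono[of "z ` {..<m}" "insert r (z ` {..<m})"] by blast
  show ?thesis
  proof (cases "g = 0")
    case True
    have "finite ((\<lambda>i x. cinner x (z i)) ` {..<m})"
      "\<And>\<phi>. \<phi> \<in> (\<lambda>i x. cinner x (z i)) ` {..<m} \<Longrightarrow> bounded_functional \<phi>"
      using bounded_functional_cinner by auto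
    from unit_vector_in_kernels_small_form[OF T W this zero_less_one]
    obtain r where "norm r = 1" "\<And>\<phi>. \<phi> \<in> (\<lambda>i x. cinner x (z i)) ` {..<m} \<Longrightarrow> \<phi> r = 0"
      by metis
    then show ?thesis using True fg(1) f[of r] by (intro that[of r]) auto
  next
    case False
    define r where "r = (1 / norm g) *\<^sub>R g"
    have "g = complex_of_real (norm g) *\<^sub>C r"
      using False by (simp add: r_def flip: scaleR_eq_scaleC)
    then have "g \<in> complex_vector.span (insert r (z ` {..<m}))"
      by (metis complex_vector.span_base complex_vector.span_scale insertI1)
    then show ?thesis using False fg f[of r]
      by (intro that[of r]) (auto simp: r_def cinner.scaleR_left complex_vector.span_add)
  qed
qed

text \<open>The even positions of the constructed sequence absorb the dense sequence, so that the whole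
  sequence spans a dense subspace. The vectors in odd positions are invisible to \<open>T\<close>: the
  matrix of \<open>T\<close> vanishes between them and everything chosen before, and is tiny on the diagonal.\<close>

lemma split_orthonormal_basis:
  fixes T :: "'a::complex_inner \<Rightarrow> 'a"
  assumes sep: "separable_space (euclidean :: 'a topology)"
    and T: "bounded_clinear T" and W: "0 \<in> essential_numerical_range T"
    and \<epsilon>: "\<And>n. \<epsilon> n > 0"
  obtains e v :: "nat \<Rightarrow> 'a" where "orthonormal_sequence e" "orthonormal_sequence v"
    "\<And>i j. cinner (e i) (v j) = 0"
    "closure (complex_vector.span (range e \<union> range v)) = UNIV"
    "\<And>n k. k \<le> n \<Longrightarrow> cinner (T (v n)) (e k) = 0" "\<And>n k. k \<le> n \<Longrightarrow> cinner (T (e k)) (v n) = 0"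
    "\<And>n k. k \<noteq> n \<Longrightarrow> cinner (T (v n)) (v k) = 0"
    "\<And>n. cmod (cinner (T (v n)) (v n)) \<le> \<epsilon> n"
proof -
  obtain D :: "'a set" where D: "countable D" "closure D = UNIV"
    using sep by (auto simp: separable_space_def)
  then have "D \<noteq> {}" by auto
  define x where "x = from_nat_into D"
  have x: "range x = D" unfolding x_def using D \<open>D \<noteq> {}\<close> by (intro range_from_nat_into)
  define P where "P = (\<lambda>z m r. norm r = 1 \<and> (\<forall>i<m. cinner r (z i) = 0) \<and>
    (even m \<longrightarrow> x (m div 2) \<in> complex_vector.span (insert r (z ` {..<m}))) \<and>
    (odd m \<longrightarrow> (\<forall>i<m. cinner (T r) (z i) = 0 \<and> cinner (T (z i)) r = 0)
        \<and> cmod (cinner (T r) r) \<le> \<epsilon> (m div 2)))"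
  have orth: "cinner (z i) (z j) = (if i = j then 1 else 0)"
    if "\<And>y. y < m \<Longrightarrow> P z y (z y)" "i < m" "j < m" for z i j m
  proof (cases i j rule: linorder_cases)
    case less
    then have "cinner (z j) (z i) = 0" using that by (auto simp: P_def)
    then show ?thesis using less cinner_commute[of "z i" "z j"] by simp
  next
    case equal
    then show ?thesis using that by (auto simp: P_def cinner_self)
  next
    case greater
    then show ?thesis using that by (auto simp: P_def)
  qed
  have "\<exists>z. \<forall>m. P z m (z m)"
  proof (rule dependent_wellorder_choice)
    fix r f g and m :: nat
    assume "\<And>y. y < m \<Longrightarrow> f y = (g y :: 'a)"
    then have "f ` {..<m} = g ` {..<m}" "\<And>i. i < m \<Longrightarrow> f i = g i" by auto
    then show "P f m r = P g m r" by (simp add: P_def)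
  next
    fix m :: nat and z :: "nat \<Rightarrow> 'a"
    assume z: "\<And>y. y < m \<Longrightarrow> P z y (z y)"
    show "\<exists>r. P z m r"
    proof (cases "even m")
      case True
      have "cinner (z i) (z j) = (if i = j then 1 else 0)" if "i < m" "j < m" for i j
        using orth[of m z i j] z that by blast
      from unit_vector_capturing_in_span[OF T W this]
      obtain r where "norm r = 1" "\<And>i. i < m \<Longrightarrow> cinner r (z i) = 0"
        "x (m div 2) \<in> complex_vector.span (insert r (z ` {..<m}))"
        by metis
      then show ?thesis using True by (auto simp: P_def)
    next
      case False
      define \<Phi> where "\<Phi> = (\<Union>i<m. {\<lambda>x. cinner x (z i), \<lambda>x. cinner (T x) (z i), \<lambda>x. cinner x (T (z i))})"
      have "finite \<Phi>" "\<And>\<phi>. \<phi> \<in> \<Phi> \<Longrightarrow> bounded_functional \<phi>"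
        using bounded_functional_cinner bounded_functional_cinner_image[OF T] by (auto simp: \<Phi>_def)
      then obtain r where r: "norm r = 1" "\<And>\<phi>. \<phi> \<in> \<Phi> \<Longrightarrow> \<phi> r = 0" "cmod (cinner (T r) r) < \<epsilon> (m div 2)"
        using unit_vector_in_kernels_small_form[OF T W, of \<Phi> "\<epsilon> (m div 2)"] \<epsilon> by blast
      have "cinner r (z i) = 0 \<and> cinner (T r) (z i) = 0 \<and> cinner (T (z i)) r = 0" if "i < m" for i
      proof -
        have "(\<lambda>x. cinner x (z i)) \<in> \<Phi>" "(\<lambda>x. cinner (T x) (z i)) \<in> \<Phi>" "(\<lambda>x. cinner x (T (z i))) \<in> \<Phi>"
          using that by (auto simp: \<Phi>_def)
        then have "cinner r (z i) = 0" "cinner (T r) (z i) = 0" "cinner r (T (z i)) = 0"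
          using r(2) by blast+
        then show ?thesis using cinner_commute[of "T (z i)" r] by simp
      qed
      then show ?thesis using False r by (auto simp: P_def)
    qed
  qed
  then obtain z where z: "\<And>m. P z m (z m)" by blast
  have on: "cinner (z i) (z j) = (if i = j then 1 else 0)" for i j
    by (rule orth[of "Suc (max i j)"]) (use z in auto)
  define e where "e = (\<lambda>n. z (2 * n))"
  define v where "v = (\<lambda>n. z (Suc (2 * n)))"
  have rng: "range z = range e \<union> range v"
  proof -
    have "z n \<in> range e \<union> range v" for n by (cases "even n") (auto simp: e_def v_def elim!: evenE oddE)
    then show ?thesis by (auto simp: e_def v_def)
  qed
  have odd: "cinner (T (v n)) (z i) = 0" "cinner (T (z i)) (v n) = 0" if "i < Suc (2 * n)" for n i
    using z[of "Suc (2 * n)"] that by (auto simp: P_def v_def)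
  show ?thesis
  proof (rule that[of e v])
    show "orthonormal_sequence e" "orthonormal_sequence v" "\<And>i j. cinner (e i) (v j) = 0"
      by (auto simp: orthonormal_sequence_def e_def v_def on) presburger
    have "x n \<in> complex_vector.span (range e \<union> range v)" for n
    proof -
      have "x n \<in> complex_vector.span (insert (z (2 * n)) (z ` {..<2 * n}))"
        using z[of "2 * n"] by (simp add: P_def)
      also have "\<dots> \<subseteq> complex_vector.span (range z)" by (intro complex_vector.span_mono) auto
      finally show ?thesis by (simp add: rng)
    qed
    then have "D \<subseteq> complex_vector.span (range e \<union> range v)" using x by auto
    then show "closure (complex_vector.span (range e \<union> range v)) = UNIV"
      using D(2) closure_mono by blast
    show "cinner (T (v n)) (e k) = 0" "cinner (T (e k)) (v n) = 0" if "k \<le> n" for n k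
      using odd[of "2 * k" n] that by (auto simp: e_def)
    show "cinner (T (v n)) (v k) = 0" if "k \<noteq> n" for n k
      using odd[of "Suc (2 * k)" n] odd[of "Suc (2 * n)" k] that unfolding v_def
      by (cases "k < n") auto
    show "cmod (cinner (T (v n)) (v n)) \<le> \<epsilon> n" for n
      using z[of "Suc (2 * n)"] by (auto simp: P_def v_def)
  qed
qed

section \<open>Rotating one sequence into the other\<close>

locale rotation_scheme =
  fixes e v :: "nat \<Rightarrow> 'a::complex_inner" and \<kappa> :: "nat \<Rightarrow> nat" and t :: "nat \<Rightarrow> real"
  assumes e: "orthonormal_sequence e" and v: "orthonormal_sequence v"
    and ev: "cinner (e i) (v j) = 0"
    and t_ge_0: "0 \<le> t n" and t_le_1: "t n \<le> 1"
begin

text \<open>The vector \<open>w n k\<close> is the part of \<open>e k\<close>, rescaled to norm one, that is still to be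
  captured before step \<open>n\<close>.
  Step \<open>n\<close> rotates the plane of \<open>v n\<close> and \<open>w n (\<kappa> n)\<close> by the angle with sine \<open>sqrt (t n)\<close>:
  one of the two new vectors becomes the basis vector \<open>u n\<close>, the other one replaces \<open>w n (\<kappa> n)\<close>.\<close>

primrec w :: "nat \<Rightarrow> nat \<Rightarrow> 'a" where
  "w 0 = e"
| "w (Suc n) = (w n)(\<kappa> n := sqrt (1 - t n) *\<^sub>R w n (\<kappa> n) - sqrt (t n) *\<^sub>R v n)"

definition u :: "nat \<Rightarrow> 'a" where
  "u n = sqrt (1 - t n) *\<^sub>R v n + sqrt (t n) *\<^sub>R w n (\<kappa> n)"

lemma abs_t: "\<bar>t n\<bar> = t n" "\<bar>1 - t n\<bar> = 1 - t n"
  using t_ge_0[of n] t_le_1[of n] by auto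

lemmas cinner_lin = cinner.add_left cinner.add_right cinner.diff_left cinner.diff_right
  cinner.scaleR_left cinner.scaleR_right

lemma v_v: "cinner (v i) (v j) = (if i = j then 1 else 0)"
  using v by (simp add: orthonormal_sequence_def)

lemma w_v: "n \<le> m \<Longrightarrow> cinner (w n k) (v m) = 0"
  by (induction n arbitrary: k) (auto simp: ev cinner_lin v_v)

lemma v_w: "n \<le> m \<Longrightarrow> cinner (v m) (w n k) = 0"
  using w_v cinner_commute by (metis complex_cnj_zero)

lemma w_w: "cinner (w n k) (w n l) = (if k = l then 1 else 0)"
proof (induction n arbitrary: k l)
  case 0
  then show ?case using e by (simp add: orthonormal_sequence_def)
next
  case (Suc n)
  then show ?case
    by (auto simp: cinner_lin w_v v_w v_v abs_t simp flip: scaleR_left_distrib)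
qed

lemma norm_w: "norm (w n k) = 1"
  by (rule norm_eq_1_cinner) (simp add: w_w)

lemma v_u: "j < n \<Longrightarrow> cinner (v n) (u j) = 0"
  by (simp add: u_def cinner_lin v_v v_w)

lemma w_u: "j < n \<Longrightarrow> cinner (w n k) (u j) = 0"
proof (induction n arbitrary: k)
  case (Suc n)
  show ?case
  proof (cases "j = n")
    case True
    then show ?thesis by (auto simp: u_def cinner_lin w_v v_w v_v w_w)
  next
    case False
    then show ?thesis using Suc by (auto simp: cinner_lin v_u)
  qed
qed simp

lemma orthonormal_u: "orthonormal_sequence u"
proof -
  have less: "cinner (u n) (u j) = 0" if "j < n" for j n
    using that by (simp add: u_def[of n] cinner_lin v_u w_u)
  have "cinner (u n) (u n) = 1" for n
    by (simp add: u_def cinner_lin v_v v_w w_v w_w abs_t flip: scaleR_left_distrib)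
  moreover have "cinner (u n) (u j) = 0" if "n < j" for j n
    using less[OF that] cinner_commute[of "u n" "u j"] by simp
  ultimately show ?thesis using less by (auto simp: orthonormal_sequence_def neq_iff)
qed

lemma norm_u: "norm (u n) = 1"
  using orthonormal_u by (intro norm_eq_1_cinner) (simp add: orthonormal_sequence_def)

lemma v_eq: "v n = sqrt (1 - t n) *\<^sub>R u n - sqrt (t n) *\<^sub>R w (Suc n) (\<kappa> n)"
  by (simp add: u_def abs_t algebra_simps)

lemma w_eq: "w n (\<kappa> n) = sqrt (t n) *\<^sub>R u n + sqrt (1 - t n) *\<^sub>R w (Suc n) (\<kappa> n)"
  by (simp add: u_def abs_t algebra_simps)

text \<open>Every step devoted to \<open>k\<close> shrinks the missing part of \<open>w m k\<close> by the factor
  \<open>sqrt (1 - t n)\<close>, which is at most \<open>exp (- t n / 2)\<close>. The product over these steps is therefore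
  controlled by the exponential of their sum.\<close>


lemma w_split:
  "\<exists>p x. x \<in> complex_vector.span (range u) \<and> w m k = x + p *\<^sub>R w (m + N) k \<and> 0 \<le> p \<and>
     p \<le> exp (- (\<Sum>n\<in>{m..<m+N}. if \<kappa> n = k then t n else 0) / 2)"
proof (induction N)
  case 0
  then show ?case by (intro exI[of _ 1] exI[of _ 0]) (simp add: complex_vector.span_zero)
next
  case (Suc N)
  then obtain p x where px: "x \<in> complex_vector.span (range u)" "w m k = x + p *\<^sub>R w (m + N) k"
    "0 \<le> p" "p \<le> exp (- (\<Sum>n\<in>{m..<m+N}. if \<kappa> n = k then t n else 0) / 2)" by blast
  let ?n = "m + N"
  show ?case
  proof (cases "\<kappa> ?n = k")
    case False
    then show ?thesis using px by (intro exI[of _ p] exI[of _ x]) auto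
  next
    case True
    have "sqrt (1 - t ?n) \<le> sqrt (exp (- t ?n))"
      using exp_ge_add_one_self[of "- t ?n"] by (intro real_sqrt_le_mono) simp
    also have "\<dots> = exp (- t ?n / 2)"
      by (intro real_sqrt_unique) (auto simp: power2_eq_square simp flip: exp_add)
    finally have "p * sqrt (1 - t ?n)
        \<le> exp (- (\<Sum>n\<in>{m..<m+N}. if \<kappa> n = k then t n else 0) / 2) * exp (- t ?n / 2)"
      using px t_le_1[of ?n] by (intro mult_mono) auto
    also have "\<dots> = exp (- (\<Sum>n\<in>{m..<m+Suc N}. if \<kappa> n = k then t n else 0) / 2)"
      using True by (simp add: add_divide_distrib flip: exp_add)
    finally have p: "p * sqrt (1 - t ?n)
        \<le> exp (- (\<Sum>n\<in>{m..<m+Suc N}. if \<kappa> n = k then t n else 0) / 2)" .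
    have "w m k = (x + (p * sqrt (t ?n)) *\<^sub>R u ?n) + (p * sqrt (1 - t ?n)) *\<^sub>R w (Suc ?n) k"
      using px(2) w_eq[of ?n] True by (simp add: scaleR_right_distrib del: w.simps)
    moreover have "x + (p * sqrt (t ?n)) *\<^sub>R u ?n \<in> complex_vector.span (range u)"
      unfolding scaleR_eq_scaleC
      by (intro complex_vector.span_add px(1) complex_vector.span_scale complex_vector.span_base) auto
    ultimately show ?thesis using p px(3) t_le_1[of ?n]
      by (intro exI[of _ "p * sqrt (1 - t ?n)"] exI[of _ "x + (p * sqrt (t ?n)) *\<^sub>R u ?n"])
        (simp del: w.simps)
  qed
qed

lemma w_in_closure:
  assumes "\<not> summable (\<lambda>n. if \<kappa> n = k then t n else 0)"
  shows "w m k \<in> closure (complex_vector.span (range u))"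
proof (rule closure_approachable[THEN iffD2], intro allI impI)
  fix \<delta> :: real assume "\<delta> > 0"
  let ?f = "\<lambda>n. if \<kappa> n = k then t n else 0"
  have "\<not> summable (\<lambda>n. ?f (n + m))" using assms by (subst summable_iff_shift)
  then have "\<exists>N. (\<Sum>n<N. ?f (n + m)) > B" for B
    using summableI_nonneg_bounded[of "\<lambda>n. ?f (n + m)" B] t_ge_0 by (force simp: not_le)
  then obtain N where "(\<Sum>n<N. ?f (n + m)) > - 2 * ln \<delta>" by blast
  moreover have "(\<Sum>n<N. ?f (n + m)) = (\<Sum>n\<in>{m..<m+N}. ?f n)"
    using sum.shift_bounds_nat_ivl[of ?f 0 m N] by (simp add: atLeast0LessThan add.commute)
  ultimately have "exp (- (\<Sum>n\<in>{m..<m+N}. ?f n) / 2) < exp (ln \<delta>)" by simp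
  moreover obtain p x where "x \<in> complex_vector.span (range u)" "w m k = x + p *\<^sub>R w (m + N) k"
    "0 \<le> p" "p \<le> exp (- (\<Sum>n\<in>{m..<m+N}. ?f n) / 2)" using w_split[of m k N] by blast
  ultimately show "\<exists>y\<in>complex_vector.span (range u). dist y (w m k) < \<delta>"
    using \<open>\<delta> > 0\<close> by (intro bexI[of _ x]) (auto simp: dist_norm norm_w)
qed

end

lemma closure_complex_span_subspace:
  fixes S :: "'a::complex_inner set"
  shows "complex_vector.subspace (closure (complex_vector.span S))"
proof (rule complex_vector.subspaceI)
  show "0 \<in> closure (complex_vector.span S)"
    using closure_subset complex_vector.span_zero by blast
next
  fix x y assume "x \<in> closure (complex_vector.span S)" "y \<in> closure (complex_vector.span S)"
  then obtain f g where "\<And>n. f n \<in> complex_vector.span S" "f \<longlonglongrightarrow> x"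
    "\<And>n. g n \<in> complex_vector.span S" "g \<longlonglongrightarrow> y" unfolding closure_sequential by blast
  then show "x + y \<in> closure (complex_vector.span S)" unfolding closure_sequential
    by (intro exI[of _ "\<lambda>n. f n + g n"]) (auto intro: tendsto_add complex_vector.span_add)
next
  fix c x assume "x \<in> closure (complex_vector.span S)"
  then obtain f where f: "\<And>n. f n \<in> complex_vector.span S" "f \<longlonglongrightarrow> x"
    unfolding closure_sequential by blast
  have "bounded_linear ((*\<^sub>C) c :: 'a \<Rightarrow> 'a)"
    by (intro bounded_linear_intro[of _ "cmod c"])
      (auto simp: scaleC_add_right scaleR_eq_scaleC scaleC_scaleC mult.commute norm_scaleC)
  from bounded_linear.tendsto[OF this f(2)] f(1)
  show "c *\<^sub>C x \<in> closure (complex_vector.span S)" unfolding closure_sequential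
    by (intro exI[of _ "\<lambda>n. c *\<^sub>C f n"]) (auto intro: complex_vector.span_scale)
qed

lemma (in rotation_scheme) orthonormal_basis_u:
  assumes dense: "closure (complex_vector.span (range e \<union> range v)) = UNIV"
    and div: "\<And>k. \<not> summable (\<lambda>n. if \<kappa> n = k then t n else 0)"
  shows "orthonormal_basis u"
proof -
  let ?C = "closure (complex_vector.span (range u))"
  note sub = closure_complex_span_subspace[of "range u"]
  have w: "w m k \<in> ?C" for m k by (rule w_in_closure[OF div])
  have u: "u n \<in> ?C" for n
    by (intro subsetD[OF closure_subset] complex_vector.span_base) simp
  have "v n \<in> ?C" for n
    unfolding v_eq[of n] scaleR_eq_scaleC
    by (intro complex_vector.subspace_diff[OF sub] complex_vector.subspace_scale[OF sub] u w)
  moreover have "e k \<in> ?C" for k using w[of 0 k] by simp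
  ultimately have "complex_vector.span (range e \<union> range v) \<subseteq> ?C"
    by (intro complex_vector.span_minimal sub) auto
  then have "?C = UNIV" using dense closure_minimal[OF _ closed_closure] by blast
  then show ?thesis using orthonormal_u by (simp add: orthonormal_basis_def)
qed

section \<open>Matrix entries of a bilinear form in the rotated basis\<close>

text \<open>Only real scalars enter the rotations, so real bilinearity suffices. This lets one lemma serve
  both \<open>cinner (T x) y\<close> and \<open>cinner (T y) x\<close>, that is, both triangles of the matrix of \<open>T\<close>.\<close>

locale rotation_scheme_form = rotation_scheme e v \<kappa> t
  for e v :: "nat \<Rightarrow> 'a::complex_inner" and \<kappa> t +
  fixes B :: "'a \<Rightarrow> 'a \<Rightarrow> complex" and M :: real
  assumes B: "bounded_bilinear B"
    and B_bound: "cmod (B x y) \<le> M * norm x * norm y"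
    and \<kappa>_le: "\<kappa> n \<le> n"
    and B_v_e: "k \<le> n \<Longrightarrow> B (v n) (e k) = 0" and B_e_v: "k \<le> n \<Longrightarrow> B (e k) (v n) = 0"
    and B_v_v: "k \<noteq> n \<Longrightarrow> B (v n) (v k) = 0"
    and B_diag: "cmod (B (v n) (v n)) \<le> t n"
begin

sublocale B: bounded_bilinear B by (rule B)

lemmas B_lin = B.add_left B.add_right B.diff_left B.diff_right B.scaleR_left B.scaleR_right

lemma B_w_v: "k \<le> m \<Longrightarrow> n \<le> m \<Longrightarrow> B (w n k) (v m) = 0"
  by (induction n arbitrary: k) (auto simp: B_e_v B_lin B_v_v)

lemma B_v_w: "k \<le> m \<Longrightarrow> n \<le> m \<Longrightarrow> B (v m) (w n k) = 0"
  by (induction n arbitrary: k) (auto simp: B_v_e B_lin B_v_v)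

lemma B_v_u: "j < n \<Longrightarrow> B (v n) (u j) = 0"
  using \<kappa>_le[of j] by (simp add: u_def B_lin B_v_v B_v_w)

lemma B_w_w: "cmod (B (w n k) (w n l)) \<le> M"
  using B_bound[of "w n k" "w n l"] by (simp add: norm_w)

lemma cmod_B_v_v_le: "cmod (B (v n) (v n)) \<le> 1"
  using B_diag[of n] t_le_1[of n] by linarith

text \<open>At the step that creates \<open>u j\<close>, the mixed entries between \<open>v j\<close> and the remainders of \<open>e k\<close> with
  \<open>k \<le> j\<close> vanish. What is left is \<open>sqrt (t j)\<close> times an entry between two remainders or, for the
  remainder that is being rotated, \<open>sqrt (t j)\<close> times at most the difference of the two diagonal
  entries. Later steps can only shrink the entry, since they multiply the remainder by
  \<open>sqrt (1 - t n)\<close> and add a multiple of some \<open>v n\<close> with \<open>B (v n) (u j) = 0\<close>.\<close>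

lemma B_w_u:
  assumes "k \<le> j" "j < n"
  shows "cmod (B (w n k) (u j)) \<le> sqrt (t j) * (M + 1)"
  using assms(2)
proof (induction n)
  case (Suc n)
  have M: "M \<ge> 0" using B_w_w[of 0 0 0] norm_ge_zero order_trans by blast
  show ?case
  proof (cases "j = n")
    case [simp]: True
    show ?thesis
    proof (cases "k = \<kappa> j")
      case False
      then have "B (w (Suc n) k) (u j) = sqrt (t j) *\<^sub>R B (w n k) (w n (\<kappa> j))"
        using assms by (simp add: u_def B_lin B_w_v)
      moreover have "cmod (B (w n k) (w n (\<kappa> j))) \<le> M + 1" using B_w_w by (meson add_increasing2 zero_le_one)
      ultimately show ?thesis using t_ge_0[of j] by (simp add: mult_left_mono)
    next
      case True
      let ?W = "B (w n k) (w n k)" and ?V = "B (v n) (v n)"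
      have "B (w (Suc n) k) (u j) = (sqrt (1 - t j) * sqrt (t j)) *\<^sub>R (?W - ?V)"
        using assms True
        by (simp add: u_def B_lin B_w_v B_v_w scaleR_right_diff_distrib mult.commute)
      moreover have "cmod (?W - ?V) \<le> M + 1"
        using norm_triangle_ineq4[of ?W ?V] B_w_w[of n k k] cmod_B_v_v_le[of n] by linarith
      moreover have "sqrt (1 - t j) * sqrt (t j) \<le> sqrt (t j)"
        using t_ge_0[of j] t_le_1[of j] by (intro mult_left_le_one_le) auto
      ultimately show ?thesis
        using t_ge_0[of j] t_le_1[of j] mult_mono[of "sqrt (1 - t j) * sqrt (t j)" "sqrt (t j)" "cmod (?W - ?V)" "M + 1"]
        by simp
    qed
  next
    case False
    then have "j < n" using Suc.prems by simp
    show ?thesis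
    proof (cases "k = \<kappa> n")
      case True
      then have "B (w (Suc n) k) (u j) = sqrt (1 - t n) *\<^sub>R B (w n k) (u j)"
        using \<open>j < n\<close> by (simp add: B_lin B_v_u)
      moreover have "sqrt (1 - t n) * cmod (B (w n k) (u j)) \<le> cmod (B (w n k) (u j))"
        using t_ge_0[of n] t_le_1[of n] by (intro mult_left_le_one_le) auto
      ultimately show ?thesis using Suc.IH[OF \<open>j < n\<close>] t_le_1[of n] by simp
    qed (use Suc.IH[OF \<open>j < n\<close>] in simp)
  qed
qed simp

lemma B_u_u_less:
  assumes "j < n"
  shows "cmod (B (u n) (u j)) \<le> sqrt (t n) * (if \<kappa> n \<le> j then sqrt (t j) * (M + 1) else M)"
proof -
  have "B (u n) (u j) = sqrt (t n) *\<^sub>R B (w n (\<kappa> n)) (u j)"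
    using assms by (simp add: u_def[of n] B_lin B_v_u)
  moreover have "cmod (B (w n (\<kappa> n)) (u j)) \<le> (if \<kappa> n \<le> j then sqrt (t j) * (M + 1) else M)"
    using B_w_u[of "\<kappa> n" j n] B_bound[of "w n (\<kappa> n)" "u j"] assms by (simp add: norm_w norm_u)
  ultimately show ?thesis using t_ge_0[of n] by (simp add: mult_left_mono)
qed

lemma B_u_u_diag: "cmod (B (u n) (u n)) \<le> t n * (M + 1)"
proof -
  let ?W = "B (w n (\<kappa> n)) (w n (\<kappa> n))" and ?V = "B (v n) (v n)"
  have "B (u n) (u n) = (1 - t n) *\<^sub>R ?V + t n *\<^sub>R ?W"
    by (simp add: u_def B_lin B_w_v B_v_w \<kappa>_le scaleR_right_distrib abs_t)
  also have "cmod \<dots> \<le> (1 - t n) * cmod ?V + t n * cmod ?W"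
    using norm_triangle_ineq[of "(1 - t n) *\<^sub>R ?V" "t n *\<^sub>R ?W"] t_ge_0[of n] t_le_1[of n] by simp
  also have "\<dots> \<le> 1 * t n + t n * M"
    using B_diag[of n] B_w_w t_ge_0[of n] t_le_1[of n] by (intro add_mono mult_mono) auto
  finally show ?thesis by (simp add: algebra_simps)
qed

end

section \<open>Distributing a divergent series\<close>

text \<open>Cut the indices into blocks by the integer part of the partial sums. As every term is at most
  \<open>1/2\<close>, a block with positive number starts less than \<open>1/2\<close> above that integer, so that its own sum
  exceeds \<open>1/2\<close>. Pairing gives infinitely many blocks to every \<open>k\<close>, which makes
  all the partial series diverge, and \<open>\<kappa> n \<le> n\<close> because the partial sums are at most \<open>n\<close>.\<close>

lemma split_divergent_series:
  fixes a :: "nat \<Rightarrow> real"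
  assumes a: "\<And>n. 0 < a n" "\<And>n. a n \<le> 1 / 2" and div: "\<not> summable a"
  obtains \<kappa> :: "nat \<Rightarrow> nat" where "\<And>n. \<kappa> n \<le> n" "\<And>k. \<not> summable (\<lambda>n. if \<kappa> n = k then a n else 0)"
proof
  define S where "S = (\<lambda>n. \<Sum>i<n. a i)"
  define \<kappa> where "\<kappa> = (\<lambda>n. fst (prod_decode (nat \<lfloor>S n\<rfloor>)))"
  have S_mono: "S m \<le> S n" if "m \<le> n" for m n
    unfolding S_def using that a(1) by (intro sum_mono2) (auto intro: less_imp_le)
  have S0: "S 0 = 0" and SS: "S (Suc n) = S n + a n" for n by (auto simp: S_def)
  have S_le: "S n \<le> n" for n
    using sum_bounded_above[of "{..<n}" a 1] order_trans[OF a(2), of 1] by (simp add: S_def)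
  have S_unb: "\<exists>n. S n \<ge> B" for B
  proof (rule ccontr)
    assume "\<nexists>n. S n \<ge> B"
    then have "summable a" using a(1)
      by (intro summableI_nonneg_bounded[where x = B]) (auto simp: S_def not_le intro: less_imp_le)
    then show False using div by simp
  qed
  show "\<kappa> n \<le> n" for n
  proof -
    note S_le[of n]
    moreover have "S n \<ge> 0" using S_mono[of 0 n] S0 by simp
    ultimately have "nat \<lfloor>S n\<rfloor> \<le> n" by linarith
    moreover have "\<kappa> n \<le> nat \<lfloor>S n\<rfloor>"
      unfolding \<kappa>_def using le_prod_encode_1[of "fst (prod_decode (nat \<lfloor>S n\<rfloor>))" "snd (prod_decode (nat \<lfloor>S n\<rfloor>))"]
      by simp
    ultimately show ?thesis by simp
  qed
  show "\<not> summable (\<lambda>n. if \<kappa> n = k then a n else 0)" for k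
  proof
    let ?f = "\<lambda>n. if \<kappa> n = k then a n else 0"
    assume "summable ?f"
    then obtain N where N: "\<And>m n. m \<ge> N \<Longrightarrow> \<bar>sum ?f {m..<n}\<bar> < 1 / 2"
      unfolding summable_Cauchy by (metis half_gt_zero_iff real_norm_def zero_less_one)
    \<comment> \<open>The number of a block that belongs to \<open>k\<close> and starts after \<open>N\<close>.\<close>
    define i where "i = prod_encode (k, Suc N)"
    have "i \<ge> Suc N" unfolding i_def by (rule le_prod_encode_2)
    define p where "p = (LEAST n. S n \<ge> i)"
    define q where "q = (LEAST n. S n \<ge> i + 1)"
    have p: "S p \<ge> i" unfolding p_def using S_unb by (rule LeastI_ex)
    have q: "S q \<ge> i + 1" unfolding q_def using S_unb by (rule LeastI_ex)
    have pl: "S n < i" if "n < p" for n using not_less_Least[of n "\<lambda>n. S n \<ge> i"] that by (simp add: p_def not_le)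
    have ql: "S n < i + 1" if "n < q" for n using not_less_Least[of n "\<lambda>n. S n \<ge> i + 1"] that by (simp add: q_def not_le)
    have "p \<noteq> 0" using p S0 \<open>i \<ge> Suc N\<close> by (intro notI) auto
    then obtain p' where p': "p = Suc p'" using not0_implies_Suc by blast
    have "S p < i + 1 / 2" using pl[of p'] SS[of p'] a(2)[of p'] p' by simp
    moreover have "p \<le> q" unfolding p_def by (rule Least_le) (use q in simp)
    then have "S q = S p + sum a {p..<q}"
      unfolding S_def by (simp add: lessThan_atLeast0 sum.atLeastLessThan_concat)
    ultimately have "sum a {p..<q} > 1 / 2" using q by linarith
    also have "sum a {p..<q} = sum ?f {p..<q}"
    proof (rule sum.cong[OF refl])
      fix n assume "n \<in> {p..<q}"
      then have "S n \<ge> i" "S n < i + 1" using S_mono[of p n] p ql[of n] by auto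
      then have "nat \<lfloor>S n\<rfloor> = i" by linarith
      then show "a n = ?f n" by (simp add: \<kappa>_def i_def)
    qed
    finally have "sum ?f {p..<q} > 1 / 2" .
    moreover have "p \<ge> N"
    proof (rule ccontr)
      assume "\<not> p \<ge> N"
      then show False using S_le[of p] p \<open>\<not> p \<ge> N\<close> \<open>i \<ge> Suc N\<close> by linarith
    qed
    ultimately show False using N[of p q] by linarith
  qed
qed

lemma not_summable_min:
  fixes a :: "nat \<Rightarrow> real"
  assumes "\<And>n. 0 < a n" "\<not> summable a" "c > 0"
  shows "\<not> summable (\<lambda>n. min (a n) c)"
proof
  assume s: "summable (\<lambda>n. min (a n) c)"
  then have "\<forall>\<^sub>F n in sequentially. min (a n) c < c"
    using summable_LIMSEQ_zero \<open>c > 0\<close> by (intro order_tendstoD) auto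
  then have "\<forall>\<^sub>F n in sequentially. min (a n) c = a n" by eventually_elim auto
  from summable_cong[OF this] show False using s assms(2) by simp
qed

section \<open>Small matrices and the essential numerical range\<close>

text \<open>The bound \<open>a n \<le> 1/2\<close> is harmless, because a divergent series of positive terms still
  diverges after truncation at a positive constant.\<close>

lemma orthonormal_basis_small_matrix:
  fixes T :: "'a::complex_inner \<Rightarrow> 'a" and a :: "nat \<Rightarrow> real"
  assumes sep: "separable_space (euclidean :: 'a topology)"
    and T: "bounded_clinear T" and W: "0 \<in> essential_numerical_range T"
    and a: "\<And>n. 0 < a n" "\<And>n. a n \<le> 1 / 2" and div: "\<not> summable a"
  obtains u :: "nat \<Rightarrow> 'a" where "orthonormal_basis u"
    "\<And>n j. cmod (cinner (T (u n)) (u j)) \<le> sqrt (a n * a j)"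
proof -
  interpret T: bounded_linear T using T by (simp add: bounded_clinear_def)
  obtain M where M: "\<And>x. norm (T x) \<le> norm x * M" "M \<ge> 0" using T.nonneg_bounded by blast
  obtain \<kappa> :: "nat \<Rightarrow> nat" where \<kappa>: "\<And>n. \<kappa> n \<le> n"
    "\<And>k. \<not> summable (\<lambda>n. if \<kappa> n = k then a n else 0)"
    using split_divergent_series[OF a div] by blast
  define C where "C = M + 1"
  have C: "C \<ge> 1" using M by (simp add: C_def)
  \<comment> \<open>The bound \<open>1 / C\<close> turns a matrix entry of size \<open>C * sqrt (t n * t j)\<close> into \<open>sqrt (a n * a j)\<close>.
    The vectors \<open>u j\<close> with \<open>j < k\<close> are built without regard to \<open>e k\<close>; their entries against steps
    devoted to \<open>k\<close> are only \<open>O(sqrt (t n))\<close>, for which the other bounds compensate.\<close>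
  define c where "c = (\<lambda>k. Min (insert (1 / C) ((\<lambda>j. a j / C\<^sup>2) ` {..<k})))"
  have c0: "c k > 0" and c1: "c k \<le> 1 / C" for k
    using C a(1) by (auto simp: c_def Min_gr_iff)
  have c2: "c k \<le> a j / C\<^sup>2" if "j < k" for j k
    unfolding c_def using that by (intro Min_le) auto
  have c_le_1: "c k \<le> 1" for k using c1[of k] C by (smt (verit) divide_le_eq_1)
  define t where "t = (\<lambda>n. c (\<kappa> n) * a n)"
  have t: "t n > 0" "t n \<le> 1" for n
  proof -
    show "t n > 0" using c0 a(1) by (simp add: t_def)
    have "t n \<le> 1 * (1 / 2)" unfolding t_def using c0[of "\<kappa> n"] c_le_1 a
      by (intro mult_mono) (auto intro: less_imp_le)
    then show "t n \<le> 1" by simp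
  qed
  have tdiv: "\<not> summable (\<lambda>n. if \<kappa> n = k then t n else 0)" for k
  proof
    assume "summable (\<lambda>n. if \<kappa> n = k then t n else 0)"
    then have "summable (\<lambda>n. inverse (c k) * (if \<kappa> n = k then t n else 0))" by (rule summable_mult)
    moreover have "(\<lambda>n. inverse (c k) * (if \<kappa> n = k then t n else 0)) = (\<lambda>n. if \<kappa> n = k then a n else 0)"
      using c0[of k] by (auto simp: t_def)
    ultimately show False using \<kappa>(2) by simp
  qed
  obtain e v :: "nat \<Rightarrow> 'a" where ev: "orthonormal_sequence e" "orthonormal_sequence v"
    "\<And>i j. cinner (e i) (v j) = 0"
    "closure (complex_vector.span (range e \<union> range v)) = UNIV"
    "\<And>n k. k \<le> n \<Longrightarrow> cinner (T (v n)) (e k) = 0" "\<And>n k. k \<le> n \<Longrightarrow> cinner (T (e k)) (v n) = 0"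
    "\<And>n k. k \<noteq> n \<Longrightarrow> cinner (T (v n)) (v k) = 0"
    "\<And>n. cmod (cinner (T (v n)) (v n)) \<le> t n"
    using split_orthonormal_basis[OF sep T W, of t] t by blast
  have T_bound: "cmod (cinner (T x) y) \<le> M * norm x * norm y" for x y
    using Cauchy_Schwarz_cinner[of "T x" y] mult_right_mono[OF M(1)[of x] norm_ge_zero[of y]]
    by (simp add: mult.commute)
  have bil: "bounded_bilinear (\<lambda>x y. cinner (T x) y)"
    using bounded_bilinear.comp1[OF cinner.bounded_bilinear_axioms T.bounded_linear_axioms] .
  have bil': "bounded_bilinear (\<lambda>x y. cinner (T y) x)"
    using bounded_bilinear.flip[OF bil] .
  have T_bound': "cmod (cinner (T y) x) \<le> M * norm x * norm y" for x y
    using T_bound[of y x] by (simp add: mult_ac)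
  have scheme: "rotation_scheme e v t"
    using ev(1-3) t by unfold_locales (auto intro: less_imp_le)
  interpret lower: rotation_scheme_form e v \<kappa> t "\<lambda>x y. cinner (T x) y" M
    by (intro rotation_scheme_form.intro scheme rotation_scheme_form_axioms.intro)
      (fact bil T_bound \<kappa>(1) ev(5-8))+
  interpret upper: rotation_scheme_form e v \<kappa> t "\<lambda>x y. cinner (T y) x" M
    by (intro rotation_scheme_form.intro scheme rotation_scheme_form_axioms.intro)
      (fact bil' T_bound' \<kappa>(1) ev(5,6,8) ev(7)[OF not_sym])+
  have diag: "t n * (M + 1) \<le> sqrt (a n * a n)" for n
  proof -
    have "c (\<kappa> n) * C \<le> 1" using c1[of "\<kappa> n"] C by (simp add: field_simps)
    then have "c (\<kappa> n) * C * a n \<le> 1 * a n" using a(1)[of n] by (intro mult_right_mono) auto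
    then show ?thesis using a(1)[of n] by (simp add: t_def C_def mult_ac)
  qed
  have off: "sqrt (t n) * (if \<kappa> n \<le> j then sqrt (t j) * (M + 1) else M) \<le> sqrt (a n * a j)" for n j
  proof (cases "\<kappa> n \<le> j")
    case True
    have "t n * t j * C\<^sup>2 = (c (\<kappa> n) * C) * (c (\<kappa> j) * C) * (a n * a j)"
      by (simp add: t_def power2_eq_square)
    also have "\<dots> \<le> (1 * 1) * (a n * a j)"
    proof (intro mult_mono)
      show "c (\<kappa> n) * C \<le> 1" "c (\<kappa> j) * C \<le> 1" using c1[of "\<kappa> n"] c1[of "\<kappa> j"] C by (auto simp: field_simps)
    qed (use c0[of "\<kappa> n"] c0[of "\<kappa> j"] C a(1)[of n] a(1)[of j] in auto)
    finally have "sqrt (t n * t j * C\<^sup>2) \<le> sqrt (a n * a j)" by simp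
    then show ?thesis using True C by (simp add: C_def real_sqrt_mult)
  next
    case False
    then have "c (\<kappa> n) * C\<^sup>2 \<le> a j" using c2[of j "\<kappa> n"] C by (simp add: field_simps)
    then have "t n * C\<^sup>2 \<le> a n * a j" using a(1)[of n] by (simp add: t_def mult_ac mult_left_mono)
    then have "sqrt (t n * C\<^sup>2) \<le> sqrt (a n * a j)" by (rule real_sqrt_le_mono)
    then have "sqrt (t n) * C \<le> sqrt (a n * a j)" using C by (simp add: real_sqrt_mult)
    moreover have "sqrt (t n) * M \<le> sqrt (t n) * C" using t(1)[of n] by (intro mult_left_mono) (auto simp: C_def)
    ultimately show ?thesis using False by simp
  qed
  show ?thesis
  proof (rule that[of lower.u])
    show "orthonormal_basis lower.u" by (rule lower.orthonormal_basis_u[OF ev(4) tdiv])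
    show "cmod (cinner (T (lower.u n)) (lower.u j)) \<le> sqrt (a n * a j)" for n j
    proof (cases n j rule: linorder_cases)
      case less
      then show ?thesis using upper.B_u_u_less[OF less] off[of j n] by (simp add: mult.commute)
    next
      case equal
      then show ?thesis using lower.B_u_u_diag[of n] diag[of n] by simp
    next
      case greater
      then show ?thesis using lower.B_u_u_less[OF greater] off[of n j] by simp
    qed
  qed
qed

lemma zero_in_essential_numerical_range_small_matrix:
  assumes u: "orthonormal_basis u" and le: "\<And>n. cmod (cinner (T (u n)) (u n)) \<le> b n" and b: "b \<longlonglongrightarrow> 0"
  shows "0 \<in> essential_numerical_range T"
proof -
  have "(\<lambda>n. cinner (T (u n)) (u n)) \<longlonglongrightarrow> 0"
    by (rule Lim_null_comparison[OF _ b]) (simp add: le always_eventually)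
  then show ?thesis using u by (auto simp: essential_numerical_range_def orthonormal_basis_def)
qed

theorem theorem2p5:
  fixes T :: "'a::complex_hilbert_space \<Rightarrow> 'a"
  assumes "separable_space (euclidean :: 'a topology)"
    and "\<nexists>B :: 'a set. finite B \<and> complex_vector.span B = UNIV"
    and "bounded_clinear T"
  shows "0 \<in> essential_numerical_range T \<longleftrightarrow>
    (\<forall>a :: nat \<Rightarrow> real. (\<forall>n. 0 < a n) \<and> \<not> summable (\<lambda>n. \<bar>a n\<bar>) \<longrightarrow>
      (\<exists>u :: nat \<Rightarrow> 'a. orthonormal_basis u \<and>
        (\<forall>n j. cmod (cinner (T (u n)) (u j)) \<le> sqrt (a n * a j))))"
proof (intro iffI allI impI, elim conjE)
  fix a :: "nat \<Rightarrow> real"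
  assume W: "0 \<in> essential_numerical_range T" and a: "\<forall>n. 0 < a n" and div: "\<not> summable (\<lambda>n. \<bar>a n\<bar>)"
  define b where "b = (\<lambda>n. min (a n) (1 / 2))"
  have b: "0 < b n" "b n \<le> 1 / 2" "b n \<le> a n" for n using a by (auto simp: b_def)
  have "(\<lambda>n. \<bar>a n\<bar>) = a" using a by (simp add: fun_eq_iff abs_of_pos)
  then have "\<not> summable b" unfolding b_def using a div by (intro not_summable_min) auto
  then obtain u :: "nat \<Rightarrow> 'a" where u: "orthonormal_basis u"
    "\<And>n j. cmod (cinner (T (u n)) (u j)) \<le> sqrt (b n * b j)"
    using orthonormal_basis_small_matrix[OF assms(1,3) W, of b] b by blast
  have "sqrt (b n * b j) \<le> sqrt (a n * a j)" for n j
    using b(1)[of n] b(1)[of j] b(3)[of n] b(3)[of j]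
    by (intro real_sqrt_le_mono mult_mono) auto
  then show "\<exists>u :: nat \<Rightarrow> 'a. orthonormal_basis u \<and>
      (\<forall>n j. cmod (cinner (T (u n)) (u j)) \<le> sqrt (a n * a j))"
    using u order_trans by blast
next
  assume ii: "\<forall>a :: nat \<Rightarrow> real. (\<forall>n. 0 < a n) \<and> \<not> summable (\<lambda>n. \<bar>a n\<bar>) \<longrightarrow>
      (\<exists>u :: nat \<Rightarrow> 'a. orthonormal_basis u \<and>
        (\<forall>n j. cmod (cinner (T (u n)) (u j)) \<le> sqrt (a n * a j)))"
  define h where "h = (\<lambda>n. inverse (real (Suc n)))"
  have h0: "h n > 0" for n by (simp add: h_def)
  have "\<not> summable h"
    using not_summable_harmonic[where 'a = real] summable_Suc_iff[of "\<lambda>n. inverse (real n)"]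
    unfolding h_def by simp
  moreover have "(\<lambda>n. \<bar>h n\<bar>) = h" using h0 by (simp add: fun_eq_iff abs_of_pos)
  ultimately obtain u :: "nat \<Rightarrow> 'a" where u: "orthonormal_basis u"
    "\<And>n j. cmod (cinner (T (u n)) (u j)) \<le> sqrt (h n * h j)"
    using ii[rule_format, of h] h0 by auto
  have "cmod (cinner (T (u n)) (u n)) \<le> h n" for n
    using u(2)[of n n] h0[of n] by simp
  then show "0 \<in> essential_numerical_range T"
    using u(1) LIMSEQ_inverse_real_of_nat zero_in_essential_numerical_range_small_matrix[of u T h]
    by (simp add: h_def)
qed

end
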